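(* Let $N\ge 2$, $K\in\{1,2,\dots,N-1\}$ and $\gamma_1,\gamma_2>0$. Let $\mathcal{M}:\mathbb{S}^N\to\mathbb{S}^N$ be the metric $$\mathcal{M}(\bm{V})=\begin{bmatrix}\frac{\gamma_1}{\gamma_2}\bm{1}_1 & \gamma_1\bm{1}_0\\ \gamma_1\bm{1}_0^T & \gamma_1\gamma_2\bm{1}_2\end{bmatrix}\odot\bm{V},$$ with decomposition $\mathcal{M}=\mathcal{S}^*\mathcal{S}$ given by $$\mathcal{S}(\bm{V})=\begin{bmatrix}\sqrt{\frac{\gamma_1}{\gamma_2}}\,\bm{1}_1 & \sqrt{\gamma_1}\,\bm{1}_0\\ \sqrt{\gamma_1}\,\bm{1}_0^T & \sqrt{\gamma_1\gamma_2}\,\bm{1}_2\end{bmatrix}\odot\bm{V}.$$ Then for every symmetric matrix $\bm{Z}\in\mathbb{S}^N$, $$\mathcal{S}(\bm{Z})\in\mathbb{S}^N_+\iff\bm{Z}\in\mathbb{S}^N_+ .$$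
   Context: $\mathbb{S}^N$ is the space of real symmetric $N\times N$ matrices and $\mathbb{S}^N_+$ its cone of positive semidefinite matrices. $\bm{1}_1\in\mathbb{S}^K$, $\bm{1}_0\in\mathbb{R}^{K\times(N-K)}$, $\bm{1}_2\in\mathbb{S}^{N-K}$ are all-ones matrices, and $\odot$ is the entrywise (Hadamard) product. *)

theory Defs
  imports Complex_Main "HOL-Library.FuncSet" "Jordan_Normal_Form.Matrix"
begin

definition sym_mats :: "nat \<Rightarrow> real mat set" where
  "sym_mats n = {A \<in> carrier_mat n n. transpose_mat A = A}"

definition psd_mats :: "nat \<Rightarrow> real mat set" where
  "psd_mats n = {A \<in> sym_mats n. \<forall>x \<in> carrier_vec n. 0 \<le> x \<bullet> (A *\<^sub>v x)}"

definition ones_mat :: "nat \<Rightarrow> nat \<Rightarrow> real mat" where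
  "ones_mat nr nc = mat nr nc (\<lambda>_. 1)"

text \<open>Only meaningful when both matrices have the same dimensions.\<close>
definition hadamard :: "real mat \<Rightarrow> real mat \<Rightarrow> real mat" (infixl "\<odot>" 70) where
  "A \<odot> B = mat (dim_row A) (dim_col A) (\<lambda>(i, j). A $$ (i, j) * B $$ (i, j))"

text \<open>The standard (Frobenius) inner product, the trace of \<open>A\<^sup>T B\<close>.\<close>
definition frob_inner :: "real mat \<Rightarrow> real mat \<Rightarrow> real" where
  "frob_inner A B = (\<Sum>i<dim_row A. \<Sum>j<dim_col A. A $$ (i, j) * B $$ (i, j))"

text \<open>Maps between spaces of symmetric matrices are functions on all of \<open>real mat\<close>
  of which only the values on \<open>sym_mats n\<close> matter; hence adjointness is a relation.\<close>
definition is_adjoint :: "nat \<Rightarrow> (real mat \<Rightarrow> real mat) \<Rightarrow> (real mat \<Rightarrow> real mat) \<Rightarrow> bool" where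
  "is_adjoint n T T' \<longleftrightarrow>
     T \<in> sym_mats n \<rightarrow> sym_mats n \<and> T' \<in> sym_mats n \<rightarrow> sym_mats n \<and>
     (\<forall>V \<in> sym_mats n. \<forall>W \<in> sym_mats n. frob_inner (T V) W = frob_inner V (T' W))"

text \<open>The block matrix with constant blocks \<open>a\<close>, \<open>b\<close>, \<open>b\<close>, \<open>c\<close>, the first of size \<open>k\<close>.\<close>
definition block_weight :: "nat \<Rightarrow> nat \<Rightarrow> real \<Rightarrow> real \<Rightarrow> real \<Rightarrow> real mat" where
  "block_weight n k a b c =
     four_block_mat (a \<cdot>\<^sub>m ones_mat k k) (b \<cdot>\<^sub>m ones_mat k (n - k))
       (b \<cdot>\<^sub>m transpose_mat (ones_mat k (n - k))) (c \<cdot>\<^sub>m ones_mat (n - k) (n - k))"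

lemma block_weight_index:
  assumes "k \<le> n" "i < n" "j < n"
  shows "block_weight n k a b c $$ (i, j) =
    (if i < k then if j < k then a else b else if j < k then b else c)"
  using assms by (simp add: block_weight_def ones_mat_def)

lemma block_weight_dim [simp]:
  assumes "k \<le> n"
  shows "dim_row (block_weight n k a b c) = n" "dim_col (block_weight n k a b c) = n"
  using assms by (simp_all add: block_weight_def ones_mat_def)

lemma sym_matsD:
  assumes "A \<in> sym_mats n" "i < n" "j < n"
  shows "A $$ (j, i) = A $$ (i, j)"
proof -
  have "A \<in> carrier_mat n n" "transpose_mat A = A"
    using assms(1) by (simp_all add: sym_mats_def)
  then show ?thesis
    using index_transpose_mat(1)[of i A j] assms(2, 3) by simp
qed

lemma hadamard_block_weight_sym:
  assumes "k \<le> n" "V \<in> sym_mats n"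
  shows "block_weight n k a b c \<odot> V \<in> sym_mats n"
  using assms
  by (auto simp: sym_mats_def[of n] hadamard_def block_weight_index sym_matsD[OF assms(2)]
      intro!: eq_matI)

lemma is_adjoint_hadamard_block_weight:
  assumes "k \<le> n"
  shows "is_adjoint n (\<lambda>V. block_weight n k a b c \<odot> V) (\<lambda>V. block_weight n k a b c \<odot> V)"
proof -
  have "frob_inner (block_weight n k a b c \<odot> V) W = frob_inner V (block_weight n k a b c \<odot> W)"
    if "V \<in> sym_mats n" for V W
    using that assms
    by (auto simp: frob_inner_def hadamard_def sym_mats_def intro!: sum.cong)
  then show ?thesis
    using assms by (auto simp: is_adjoint_def hadamard_block_weight_sym)
qed

text \<open>The decomposition of the metric as \<open>S\<^sup>* S\<close> holds for the given \<open>S\<close>, which is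
  self-adjoint; assuming it is therefore no restriction.\<close>
lemma metric_decomposition:
  fixes \<gamma>\<^sub>1 \<gamma>\<^sub>2 :: real
  assumes "k \<le> n" "\<gamma>\<^sub>1 > 0" "\<gamma>\<^sub>2 > 0" "V \<in> sym_mats n"
  shows "block_weight n k (\<gamma>\<^sub>1 / \<gamma>\<^sub>2) \<gamma>\<^sub>1 (\<gamma>\<^sub>1 * \<gamma>\<^sub>2) \<odot> V =
    block_weight n k (sqrt (\<gamma>\<^sub>1 / \<gamma>\<^sub>2)) (sqrt \<gamma>\<^sub>1) (sqrt (\<gamma>\<^sub>1 * \<gamma>\<^sub>2)) \<odot>
      (block_weight n k (sqrt (\<gamma>\<^sub>1 / \<gamma>\<^sub>2)) (sqrt \<gamma>\<^sub>1) (sqrt (\<gamma>\<^sub>1 * \<gamma>\<^sub>2)) \<odot> V)"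
proof -
  show ?thesis
    using assms(1)
    by (intro eq_matI)
      (use assms(2, 3) in \<open>simp_all add: hadamard_def block_weight_index abs_mult
        flip: mult.assoc real_sqrt_mult real_sqrt_divide\<close>)
qed

end

theory Submission
  imports Defs
begin

text \<open>The weight matrix of \<open>S\<close> has rank one: with \<open>p = sqrt (sqrt (\<gamma>\<^sub>1 / \<gamma>\<^sub>2))\<close> on the first \<open>K\<close>
  coordinates and \<open>p = sqrt (sqrt (\<gamma>\<^sub>1 * \<gamma>\<^sub>2))\<close> on the others, its \<open>(i, j)\<close> entry is \<open>p\<^sub>i p\<^sub>j\<close>. The only
  block where this is not immediate is the off-diagonal one, where \<open>\<gamma>\<^sub>2\<close> cancels and
  \<open>sqrt \<gamma>\<^sub>1\<close> remains. Hence \<open>S(Z) = D Z D\<close> with \<open>D\<close> the diagonal matrix of \<open>p\<close>. Such a congruence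
  preserves positive semidefiniteness (\<open>psd_diagonal_congruence\<close>), and because \<open>p > 0\<close> it is
  undone by the congruence with the reciprocals, which gives the converse.\<close>

lemma quadratic_form_eq_sum:
  assumes "A \<in> carrier_mat n n" "x \<in> carrier_vec n"
  shows "x \<bullet> (A *\<^sub>v x) = (\<Sum>i<n. \<Sum>j<n. x $ i * A $$ (i, j) * x $ j)"
  using assms
  by (auto simp: scalar_prod_def sum_distrib_left mult.assoc atLeast0LessThan intro!: sum.cong)

text \<open>The scaling can be moved from the matrix onto the vector: the form of \<open>B\<close> at \<open>x\<close> is the
  form of \<open>A\<close> at \<open>(p\<^sub>i x\<^sub>i)\<^sub>i\<close>.\<close>
lemma psd_diagonal_congruence:
  assumes A: "A \<in> psd_mats n" and B: "B \<in> carrier_mat n n"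
    and entries: "\<And>i j. i < n \<Longrightarrow> j < n \<Longrightarrow> B $$ (i, j) = p i * p j * A $$ (i, j)"
  shows "B \<in> psd_mats n"
proof -
  have A_sym: "A \<in> sym_mats n" and A_carrier: "A \<in> carrier_mat n n"
    using A by (auto simp: psd_mats_def sym_mats_def)
  have "B \<in> sym_mats n"
    using B by (auto simp: sym_mats_def entries sym_matsD[OF A_sym] intro!: eq_matI)
  moreover have "0 \<le> x \<bullet> (B *\<^sub>v x)" if x: "x \<in> carrier_vec n" for x
  proof -
    define y where "y = vec n (\<lambda>i. p i * x $ i)"
    have y: "y \<in> carrier_vec n"
      by (simp add: y_def)
    have "x \<bullet> (B *\<^sub>v x) = y \<bullet> (A *\<^sub>v y)"
      unfolding quadratic_form_eq_sum[OF B x] quadratic_form_eq_sum[OF A_carrier y]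
      by (intro sum.cong) (simp_all add: entries y_def)
    then show ?thesis
      using A y by (simp add: psd_mats_def)
  qed
  ultimately show ?thesis
    by (simp add: psd_mats_def)
qed

theorem proposition3p3:
  fixes N K :: nat and \<gamma>\<^sub>1 \<gamma>\<^sub>2 :: real
    and M S S_adj :: "real mat \<Rightarrow> real mat"
  assumes "N \<ge> 2" and "K \<in> {1..N - 1}" and "\<gamma>\<^sub>1 > 0" and "\<gamma>\<^sub>2 > 0"
    and metric: "\<forall>V \<in> sym_mats N. M V = block_weight N K (\<gamma>\<^sub>1 / \<gamma>\<^sub>2) \<gamma>\<^sub>1 (\<gamma>\<^sub>1 * \<gamma>\<^sub>2) \<odot> V"
    and factor: "\<forall>V \<in> sym_mats N.
      S V = block_weight N K (sqrt (\<gamma>\<^sub>1 / \<gamma>\<^sub>2)) (sqrt \<gamma>\<^sub>1) (sqrt (\<gamma>\<^sub>1 * \<gamma>\<^sub>2)) \<odot> V"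
    and adjoint: "is_adjoint N S S_adj"
    and decomposition: "\<forall>V \<in> sym_mats N. M V = S_adj (S V)"
  shows "\<forall>Z \<in> sym_mats N. S Z \<in> psd_mats N \<longleftrightarrow> Z \<in> psd_mats N"
proof
  fix Z assume Z: "Z \<in> sym_mats N"
  define p where "p i = sqrt (sqrt (if i < K then \<gamma>\<^sub>1 / \<gamma>\<^sub>2 else \<gamma>\<^sub>1 * \<gamma>\<^sub>2))" for i
  have K: "K \<le> N"
    using assms(2) by auto
  have p_pos: "p i > 0" for i
    using assms(3, 4) by (simp add: p_def)
  have off_diagonal: "sqrt (sqrt (\<gamma>\<^sub>1 / \<gamma>\<^sub>2)) * sqrt (sqrt (\<gamma>\<^sub>1 * \<gamma>\<^sub>2)) = sqrt \<gamma>\<^sub>1"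
    using assms(3, 4) by (simp flip: real_sqrt_mult)
  have Z_carrier: "Z \<in> carrier_mat N N"
    using Z by (simp add: sym_mats_def)
  have SZ: "S Z = block_weight N K (sqrt (\<gamma>\<^sub>1 / \<gamma>\<^sub>2)) (sqrt \<gamma>\<^sub>1) (sqrt (\<gamma>\<^sub>1 * \<gamma>\<^sub>2)) \<odot> Z"
    using factor Z by blast
  have SZ_carrier: "S Z \<in> carrier_mat N N"
    using hadamard_block_weight_sym[OF K Z] by (simp add: SZ sym_mats_def)
  have scaled: "S Z $$ (i, j) = p i * p j * Z $$ (i, j)" if "i < N" "j < N" for i j
  proof -
    have "block_weight N K (sqrt (\<gamma>\<^sub>1 / \<gamma>\<^sub>2)) (sqrt \<gamma>\<^sub>1) (sqrt (\<gamma>\<^sub>1 * \<gamma>\<^sub>2)) $$ (i, j) = p i * p j"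
      using assms(3, 4) off_diagonal
      by (simp add: block_weight_index[OF K that] p_def mult.commute)
    then show ?thesis
      using that K by (simp add: SZ hadamard_def)
  qed
  have unscaled: "Z $$ (i, j) = inverse (p i) * inverse (p j) * S Z $$ (i, j)"
    if "i < N" "j < N" for i j
    using p_pos[of i] p_pos[of j] by (simp add: scaled[OF that] field_simps)
  show "S Z \<in> psd_mats N \<longleftrightarrow> Z \<in> psd_mats N"
    using psd_diagonal_congruence[OF _ Z_carrier unscaled]
      psd_diagonal_congruence[OF _ SZ_carrier scaled] by blast
qed

end
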